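(* For every $n\geq 0$ and every $v\in\{a,b\}^n$, $$\pi(\psi(v))\leq\pi(\psi(v^{(n)}))=F_{n-1},$$ and the maximum is reached (i.e. $\pi(\psi(v))=F_{n-1}$) if and only if $v$ is one of the words $v^{(n)}$, $E(v^{(n)})$, $c(v^{(n)})$, $E(c(v^{(n)}))$.
   Context: Let $\mathcal{A}=\{a,b\}$. For $w\in\mathcal{A}^*$, $w^{(+)}$ is the shortest palindrome having $w$ as a prefix; $\psi(\varepsilon)=\varepsilon$, $\psi(vx)=(\psi(v)x)^{(+)}$ ($v\in\mathcal{A}^*$, $x\in\mathcal{A}$). $\pi(w)$ denotes the minimal period of a word $w$ (the least $p\geq1$ with $w_i=w_j$ whenever $i\equiv j\pmod p$), with the convention $\pi(\varepsilon)=1$. $v^{(n)}$ is the prefix of length $n$ of $(ab)^\omega$. $E$ is the automorphism of $\mathcal{A}^*$ exchanging $a$ and $b$. The operator $c$ on $\mathcal{A}^*$ is defined by $c(\varepsilon)=\varepsilon$, $c(x)=x$ for $x\in\mathcal{A}$, and $c(uxy)=uyx$ for $u\in\mathcal{A}^*$, $x,y\in\mathcal{A}$ (it swaps the last two letters). Fibonacci numbers: $F_{-1}=F_0=1$, $F_{n+1}=F_n+F_{n-1}$. *)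

theory Defs
  imports "HOL-Library.Sublist" "HOL-Number_Theory.Fib"
begin

datatype letter = A | B

type_synonym word = "letter list"

definition palindrome :: "word \<Rightarrow> bool" where
  "palindrome w \<longleftrightarrow> rev w = w"

text \<open>The shortest palindrome having \<open>w\<close> as a prefix.
  It exists and is unique, see \<open>pal_closure_unique\<close> below.\<close>

definition pal_closure :: "word \<Rightarrow> word" where
  "pal_closure w = (ARG_MIN length u. palindrome u \<and> prefix w u)"

text \<open>Lists are built from the left, whereas \<open>\<psi>\<close> is defined by recursion on the last letter;
  the defining equations are \<open>psi_Nil\<close> and \<open>psi_snoc\<close>.\<close>

definition psi :: "word \<Rightarrow> word" where
  "psi v = foldl (\<lambda>u x. pal_closure (u @ [x])) [] v"

lemma psi_Nil: "psi [] = []"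
  by (simp add: psi_def)

lemma psi_snoc: "psi (v @ [x]) = pal_closure (psi v @ [x])"
  by (simp add: psi_def)

text \<open>On the empty word every \<open>p \<ge> 1\<close> qualifies, so the convention
  \<open>\<pi>(\<epsilon>) = 1\<close> is built in.\<close>

definition min_period :: "word \<Rightarrow> nat" where
  "min_period w = (LEAST p. p \<ge> 1 \<and>
     (\<forall>i < length w. \<forall>j < length w. i mod p = j mod p \<longrightarrow> w ! i = w ! j))"

lemma min_period_Nil: "min_period [] = 1"
  unfolding min_period_def by (rule Least_equality) auto

definition alt_word :: "nat \<Rightarrow> word" where
  "alt_word n = map (\<lambda>i. if even i then A else B) [0..<n]"

fun exch_letter :: "letter \<Rightarrow> letter" where
  "exch_letter A = B"
| "exch_letter B = A"

definition E :: "word \<Rightarrow> word" where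
  "E w = map exch_letter w"

definition c :: "word \<Rightarrow> word" where
  "c w = (if length w < 2 then w
          else butlast (butlast w) @ [last w, last (butlast w)])"

lemma c_Nil: "c [] = []"
  by (simp add: c_def)

lemma c_single: "c [x] = [x]"
  by (simp add: c_def)

lemma c_snoc2: "c (u @ [x, y]) = u @ [y, x]"
  by (simp add: c_def butlast_append)

text \<open>The Fibonacci numbers with the indexing \<open>F\<^sub>-\<^sub>1 = F\<^sub>0 = 1\<close>, for integer indices
  \<open>k \<ge> -1\<close>. The library's \<open>fib\<close> satisfies \<open>fib 1 = fib 2 = 1\<close>, hence the shift.\<close>

definition F :: "int \<Rightarrow> nat" where
  "F k = fib (nat (k + 2))"

lemma F_minus_1: "F (-1) = 1"
  by (simp add: F_def)

lemma F_0: "F 0 = 1"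
  by (simp add: F_def numeral_2_eq_2)

lemma F_rec:
  assumes "k \<ge> 0"
  shows "F (k + 1) = F k + F (k - 1)"
proof -
  have "nat (k + 1 + 2) = Suc (Suc (nat (k + 1)))" "nat (k + 2) = Suc (nat (k + 1))"
    using assms by linarith+
  then show ?thesis
    by (simp add: F_def add.commute)
qed

lemma pal_closure_unique:
  fixes w :: word
  shows "\<exists>!u. is_arg_min length (\<lambda>u. palindrome u \<and> prefix w u) u"
proof -
  let ?P = "\<lambda>u. palindrome u \<and> prefix w u"
  have P0: "?P (w @ rev w)"
    by (simp add: palindrome_def)
  have "is_arg_min length ?P (arg_min length ?P)"
    unfolding is_arg_min_linorder using arg_min_nat_lemma[of ?P, OF P0] by blast
  moreover have "x = y" if x: "is_arg_min length ?P x" and y: "is_arg_min length ?P y" for x y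
  proof -
    have Px: "rev x = x" "prefix w x" and Py: "rev y = y" "prefix w y"
      using x y by (auto simp: is_arg_min_linorder palindrome_def)
    have len: "length x = length y"
      using x y by (simp add: is_arg_min_linorder eq_iff)
    have le: "length x \<le> 2 * length w"
      using x P0 by (auto simp: is_arg_min_linorder)
    have w1: "x ! i = w ! i" "y ! i = w ! i" if "i < length w" for i
      using Px(2) Py(2) that by (auto simp: prefix_def nth_append)
    have w2: "x ! i = y ! i" if i: "i < length x" for i
    proof (cases "i < length w")
      case True
      then show ?thesis by (simp add: w1)
    next
      case False
      then have j: "length x - Suc i < length w"
        using le i by linarith
      have "x ! i = x ! (length x - Suc i)"
        using rev_nth[OF i] Px(1) by simp
      moreover have "y ! i = y ! (length x - Suc i)"
        using rev_nth[of i y] Py(1) i len by simp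
      ultimately show ?thesis
        using j by (simp add: w1)
    qed
    show "x = y"
      by (rule nth_equalityI) (simp_all add: len w2)
  qed
  ultimately show ?thesis by blast
qed

end

theory Submission
  imports Defs
begin

text \<open>The palindromic prefixes of \<open>\<psi>(v)\<close> are the words \<open>\<psi>(u)\<close> with \<open>u\<close> a prefix of \<open>v\<close>:
  a palindromic prefix of \<open>(\<psi>(v)x)\<^sup>(\<^sup>+\<^sup>)\<close> longer than \<open>\<psi>(v)\<close> begins with \<open>\<psi>(v)x\<close>, so minimality
  makes it the whole word. Periods of a palindrome correspond to its palindromic prefixes, hence
  \<open>\<pi>(\<psi>(vx)) = |\<psi>(vx)| - |\<psi>(v)|\<close>. Writing \<open>g(v,x)\<close> for this number (\<open>gap v x\<close>), one gets \<open>g(vx,x) = g(v,x)\<close>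
  and \<open>g(vy,x) = g(v,x) + g(v,y)\<close> for \<open>y \<noteq> x\<close>, with \<open>g(\<epsilon>,x) = 1\<close>. An induction bounds
  \<open>g(v,x)\<close> and \<open>g(v,a) + g(v,b)\<close> by Fibonacci numbers, the sum being extremal exactly when \<open>v\<close>
  alternates.\<close>

section \<open>Palindromes and the length of a palindromic closure\<close>

lemma palindrome_nth_rev:
  "palindrome w \<Longrightarrow> i < length w \<Longrightarrow> w ! i = w ! (length w - Suc i)"
  by (simp add: palindrome_def flip: rev_nth)

lemma palindrome_take_nth_rev:
  "palindrome (take m w) \<Longrightarrow> m \<le> length w \<Longrightarrow> i < m \<Longrightarrow> w ! i = w ! (m - Suc i)"
  by (drule palindrome_nth_rev[of _ i]) simp_all

lemma palindrome_takeI: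
  assumes "m \<le> length w" and nth: "\<And>i. i < m \<Longrightarrow> w ! i = w ! (m - Suc i)"
  shows "palindrome (take m w)"
  unfolding palindrome_def
proof (rule nth_equalityI)
  fix i assume "i < length (rev (take m w))"
  then have "i < m" by simp
  with nth[OF this] assms(1) show "rev (take m w) ! i = take m w ! i"
    by (simp add: rev_nth)
qed simp

lemma pal_closure_properties:
  shows palindrome_pal_closure: "palindrome (pal_closure w)"
    and prefix_pal_closure: "prefix w (pal_closure w)"
    and pal_closure_le: "palindrome u \<Longrightarrow> prefix w u \<Longrightarrow> length (pal_closure w) \<le> length u"
proof -
  let ?P = "\<lambda>u. palindrome u \<and> prefix w u"
  have "?P (w @ rev w)"
    by (simp add: palindrome_def)
  from arg_min_nat_lemma[of ?P, OF this, of length]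
  show "palindrome (pal_closure w)" "prefix w (pal_closure w)"
    "palindrome u \<Longrightarrow> prefix w u \<Longrightarrow> length (pal_closure w) \<le> length u"
    unfolding pal_closure_def by auto
qed

lemma palindrome_psi: "palindrome (psi v)"
  by (cases v rule: rev_cases) (simp_all add: psi_Nil psi_snoc palindrome_pal_closure palindrome_def[of "[]"])

text \<open>Reflected in a palindrome \<open>w\<close>, a palindromic prefix followed by
  \<open>x\<close> becomes a palindromic suffix preceded by \<open>x\<close>, and so yields a
  palindromic suffix of \<open>w @ [x]\<close>. Recording lengths lets \<open>Max\<close> pick the
  longest one.\<close>

definition pal_prefixes_before :: "letter \<Rightarrow> word \<Rightarrow> nat set" where
  "pal_prefixes_before x w = {m. m < length w \<and> palindrome (take m w) \<and> w ! m = x}"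

lemma finite_pal_prefixes_before: "finite (pal_prefixes_before x w)"
  by (rule finite_subset[of _ "{..<length w}"]) (auto simp: pal_prefixes_before_def)

lemma pal_closure_snoc_le_double:
  assumes "palindrome w"
  shows "length (pal_closure (w @ [x])) \<le> 2 * length w + 1"
  using pal_closure_le[of "w @ [x] @ w" "w @ [x]"] assms by (simp add: palindrome_def)

lemma pal_closure_snoc_le:
  assumes "palindrome w" "m \<in> pal_prefixes_before x w"
  shows "length (pal_closure (w @ [x])) \<le> 2 * length w - m"
proof -
  have m: "m < length w" "palindrome (take m w)" "w ! m = x"
    using assms by (auto simp: pal_prefixes_before_def)
  \<comment> \<open>With \<open>p = take m w\<close> and \<open>d = drop m w\<close>, reversal gives
    \<open>w = rev d @ p\<close>, so \<open>w @ d = rev d @ p @ d\<close> is symmetric about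
    \<open>p\<close>.\<close>
  have "rev w = w" "rev (take m w) = take m w"
    using assms(1) m(2) by (auto simp: palindrome_def)
  then have "rev (w @ drop m w) = rev (drop m w) @ rev (take m w) @ drop m w"
    by (metis append_take_drop_id rev_append)
  also have "\<dots> = rev (take m w @ drop m w) @ drop m w"
    unfolding rev_append by simp
  finally have "palindrome (w @ drop m w)"
    using \<open>rev w = w\<close> by (simp add: palindrome_def)
  moreover have "prefix (w @ [x]) (w @ drop m w)"
    using m by (simp flip: Cons_nth_drop_Suc)
  ultimately show ?thesis
    using pal_closure_le m(1) by fastforce
qed

text \<open>Such a \<open>u\<close> starts and ends with \<open>w\<close>, and the two copies
  overlap in \<open>2 * length w - length u\<close> letters. The overlap is the centre of
  \<open>u\<close>, hence a palindrome, and it is a prefix of the second copy. The next letter sits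
  at position \<open>length w\<close> of \<open>u\<close>, which holds \<open>x\<close>.\<close>

lemma palindrome_overlap:
  assumes w: "palindrome w" and u: "palindrome u" and pre: "prefix (w @ [x]) u"
    and le: "length u \<le> 2 * length w"
  shows "2 * length w - length u \<in> pal_prefixes_before x w"
proof -
  define m where "m = 2 * length w - length u"
  have len: "length w < length u"
    using pre by (auto simp: prefix_def)
  have N: "length u = 2 * length w - m" and m: "m < length w"
    using len le by (auto simp: m_def)
  have wu: "u ! i = w ! i" if "i < length w" for i
    using pre that by (auto simp: prefix_def nth_append)
  have ux: "u ! length w = x"
    using pre by (auto simp: prefix_def nth_append)
  have w': "w ! i = w ! (length w - Suc i)" if "i < length w" for i
    by (rule palindrome_nth_rev[OF w that])
  have u': "u ! i = u ! (length u - Suc i)" if "i < length u" for i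
    by (rule palindrome_nth_rev[OF u that])
  have "w ! i = w ! (m - Suc i)" if i: "i < m" for i
  proof -
    have "w ! (m - Suc i) = w ! (length w - m + i)"
      using w'[of "m - Suc i"] i m by (simp add: algebra_simps Suc_diff_Suc)
    also have "\<dots> = u ! (length w - m + i)"
      using wu i m by simp
    also have "\<dots> = u ! (length u - Suc (length w - m + i))"
      by (rule u') (use i m len in simp)
    also have "length u - Suc (length w - m + i) = length w - Suc i"
      using N i m by simp
    also have "u ! \<dots> = w ! (length w - Suc i)"
      using wu m by simp
    also have "\<dots> = w ! i"
      by (rule w'[symmetric]) (use i m in simp)
    finally show ?thesis by (rule sym)
  qed
  then have "palindrome (take m w)"
    by (rule palindrome_takeI[OF less_imp_le[OF m]])
  moreover have "w ! m = x"
  proof -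
    have "w ! m = u ! (length w - Suc m)"
      using w'[OF m] wu m by simp
    also have "\<dots> = u ! (length u - Suc (length w - Suc m))"
      by (rule u') (use m len in simp)
    also have "length u - Suc (length w - Suc m) = length w"
      using N m by simp
    finally show ?thesis using ux by simp
  qed
  ultimately show ?thesis
    using m by (simp add: pal_prefixes_before_def flip: m_def)
qed

text \<open>The longest admissible overlap of two copies of \<open>w\<close> gives the shortest
  palindrome. If there is none, the copies cannot even be adjacent, and \<open>w @ [x] @ w\<close>
  is shortest.\<close>

lemma length_pal_closure_snoc:
  assumes "palindrome w"
  shows "length (pal_closure (w @ [x])) =
    (if pal_prefixes_before x w = {} then 2 * length w + 1
     else 2 * length w - Max (pal_prefixes_before x w))"
proof -
  let ?u = "pal_closure (w @ [x])" and ?S = "pal_prefixes_before x w"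
  have overlap: "2 * length w - length ?u \<in> ?S" if "length ?u \<le> 2 * length w"
    using palindrome_overlap[OF assms palindrome_pal_closure prefix_pal_closure that] .
  show ?thesis
  proof (cases "?S = {}")
    case True
    then show ?thesis
      using overlap pal_closure_snoc_le_double[OF assms, of x] by force
  next
    case False
    then have M: "Max ?S \<in> ?S"
      using Max_in finite_pal_prefixes_before by blast
    then have le: "length ?u \<le> 2 * length w - Max ?S"
      using pal_closure_snoc_le[OF assms] by blast
    then have "2 * length w - length ?u \<le> Max ?S"
      using overlap finite_pal_prefixes_before by (intro Max_ge) auto
    with le False show ?thesis by auto
  qed
qed

section \<open>Palindromic prefixes and lengths of the words \<open>psi v\<close>\<close>

lemma psi_snoc_decomp: obtains s where "psi (v @ [x]) = psi v @ x # s"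
  using prefix_pal_closure[of "psi v @ [x]"] by (auto simp: psi_snoc prefix_def)

lemma pal_prefix_psi_snoc:
  assumes "m < length (psi (v @ [x]))" "palindrome (take m (psi (v @ [x])))"
  shows "m \<le> length (psi v)"
proof (rule ccontr)
  assume "\<not> m \<le> length (psi v)"
  then obtain k where m: "m = length (psi v) + Suc k"
    by (metis less_iff_Suc_add not_le add_Suc_right)
  obtain s where "psi (v @ [x]) = psi v @ x # s"
    by (rule psi_snoc_decomp)
  then have "prefix (psi v @ [x]) (take m (psi (v @ [x])))"
    by (simp add: m)
  from pal_closure_le[OF assms(2) this] have "length (psi (v @ [x])) \<le> m"
    by (simp add: psi_snoc)
  with assms(1) show False by simp
qed

text \<open>The step from \<open>psi v\<close> to \<open>psi (v @ [y])\<close> creates only one new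
  proper palindromic prefix, \<open>psi v\<close> itself, and the letter after it is
  \<open>y\<close>.\<close>

lemma pal_prefixes_before_psi_snoc:
  "pal_prefixes_before x (psi (v @ [y])) =
    pal_prefixes_before x (psi v) \<union> (if x = y then {length (psi v)} else {})"
  (is "?L = ?R")
proof -
  obtain s where s: "psi (v @ [y]) = psi v @ y # s"
    by (rule psi_snoc_decomp)
  have "m \<in> ?L \<longleftrightarrow> m \<in> ?R" for m
  proof (cases m "length (psi v)" rule: linorder_cases)
    case less
    then show ?thesis by (auto simp: s pal_prefixes_before_def nth_append)
  next
    case equal
    then show ?thesis by (auto simp: s pal_prefixes_before_def palindrome_psi)
  next
    case greater
    then show ?thesis
      using pal_prefix_psi_snoc[of m v y] by (auto simp: pal_prefixes_before_def)
  qed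
  then show ?thesis by blast
qed

text \<open>Truncated subtraction is harmless here, since \<open>psi v\<close> is a proper prefix of
  \<open>psi (v @ [x])\<close>.\<close>

definition gap :: "word \<Rightarrow> letter \<Rightarrow> nat" where
  "gap v x = length (psi (v @ [x])) - length (psi v)"

lemma length_psi_snoc: "length (psi (v @ [x])) = length (psi v) + gap v x"
  by (rule psi_snoc_decomp[of v x]) (simp add: gap_def)

lemma gap_pos: "gap v x > 0"
  by (rule psi_snoc_decomp[of v x]) (simp add: gap_def)

text \<open>Both cases follow one formula if the maximum of the empty set is read as -1.\<close>

lemma gap_eq:
  "gap v x = (if pal_prefixes_before x (psi v) = {} then length (psi v) + 1
     else length (psi v) - Max (pal_prefixes_before x (psi v)))"
  using length_pal_closure_snoc[OF palindrome_psi, of v x] by (auto simp: gap_def psi_snoc)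

lemma gap_Nil: "gap [] x = 1"
  by (simp add: gap_eq psi_Nil pal_prefixes_before_def)

text \<open>In \<open>psi (v @ [x])\<close> the longest palindromic prefix followed by
  \<open>x\<close> is \<open>psi v\<close>, so a second closure with \<open>x\<close> adds as many
  letters as the first.\<close>

lemma gap_snoc_same: "gap (v @ [x]) x = gap v x"
proof -
  have "Max (insert (length (psi v)) (pal_prefixes_before x (psi v))) = length (psi v)"
    by (rule Max_eqI) (auto simp: finite_pal_prefixes_before pal_prefixes_before_def)
  then have "gap (v @ [x]) x = length (psi (v @ [x])) - length (psi v)"
    by (subst gap_eq) (simp add: pal_prefixes_before_psi_snoc)
  then show ?thesis by (simp add: length_psi_snoc)
qed

text \<open>Appending \<open>y\<close> leaves the palindromic prefixes followed by \<open>x\<close>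
  unchanged, while the length grows by \<open>gap v y\<close>.\<close>

lemma gap_snoc_diff:
  assumes "x \<noteq> y"
  shows "gap (v @ [y]) x = gap v x + gap v y"
proof -
  \<comment> \<open>This bound ensures that the truncated subtraction in \<open>gap_eq\<close>
    commutes with adding \<open>gap v y\<close>.\<close>
  have "Max (pal_prefixes_before x (psi v)) < length (psi v)"
    if "pal_prefixes_before x (psi v) \<noteq> {}"
    using Max_in[OF finite_pal_prefixes_before that] by (auto simp: pal_prefixes_before_def)
  then show ?thesis
    using assms by (cases "pal_prefixes_before x (psi v) = {}")
      (simp_all add: gap_eq[of "v @ [y]" x] gap_eq[of v x] pal_prefixes_before_psi_snoc
        length_psi_snoc)
qed

section \<open>Periods of palindromes\<close>

text \<open>Reflection in the prefix followed by reflection in the whole word is translation by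
  \<open>p\<close>.\<close>

lemma palindrome_prefix_imp_period:
  assumes w: "palindrome w" and p: "p \<le> length w" "palindrome (take (length w - p) w)"
    and i: "i + p < length w"
  shows "w ! (i + p) = w ! i"
proof -
  have "w ! i = w ! (length w - p - Suc i)"
    by (rule palindrome_take_nth_rev[OF p(2)]) (use i in simp_all)
  also have "\<dots> = w ! (length w - Suc (length w - p - Suc i))"
    by (rule palindrome_nth_rev[OF w]) (use i in simp)
  also have "length w - Suc (length w - p - Suc i) = i + p"
    using i by simp
  finally show ?thesis by simp
qed

lemma period_imp_palindrome_prefix:
  assumes w: "palindrome w" and p: "p \<le> length w"
    and per: "\<And>i. i + p < length w \<Longrightarrow> w ! (i + p) = w ! i"
  shows "palindrome (take (length w - p) w)"
proof -
  have "w ! i = w ! (length w - p - Suc i)" if i: "i < length w - p" for i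
  proof -
    have "w ! i = w ! (i + p)"
      using per[of i] i by simp
    also have "\<dots> = w ! (length w - Suc (i + p))"
      by (rule palindrome_nth_rev[OF w]) (use i in simp)
    finally show ?thesis by (simp add: add.commute)
  qed
  then show ?thesis
    by (rule palindrome_takeI[OF diff_le_self])
qed

text \<open>This bridges single shifts by \<open>p\<close>, which the reflections provide, and the
  comparison of all congruent positions in \<open>min_period\<close>: both positions are traced back
  to their common residue.\<close>

lemma shift_invariant_imp_mod_invariant:
  fixes i j p :: nat
  assumes per: "\<And>i. i + p < length w \<Longrightarrow> w ! (i + p) = w ! i"
    and ij: "i < length w" "j < length w" "i mod p = j mod p"
  shows "w ! i = w ! j"
proof -
  have multiple: "w ! (i + k * p) = w ! i" if "i + k * p < length w" for i k
    using that
  proof (induction k)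
    case (Suc k)
    then show ?case using per[of "i + k * p"] by (simp add: algebra_simps)
  qed simp
  have residue: "w ! i = w ! (i mod p)" if "i < length w" for i
    using multiple[of "i mod p" "i div p"] that by simp
  show ?thesis
    using residue[OF ij(1)] residue[OF ij(2)] ij(3) by simp
qed

lemma min_period_psi_snoc: "min_period (psi (v @ [x])) = gap v x"
  unfolding min_period_def
proof (rule Least_equality)
  let ?w = "psi (v @ [x])"
  have len: "length ?w - gap v x = length (psi v)" "gap v x \<le> length ?w"
    by (simp_all add: length_psi_snoc)
  obtain s where "?w = psi v @ x # s"
    by (rule psi_snoc_decomp)
  then have "palindrome (take (length ?w - gap v x) ?w)"
    unfolding len by (simp add: palindrome_psi)
  then have shift: "?w ! (i + gap v x) = ?w ! i" if "i + gap v x < length ?w" for i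
    using palindrome_prefix_imp_period[OF palindrome_psi len(2) _ that] by blast
  show "1 \<le> gap v x \<and> (\<forall>i<length ?w. \<forall>j<length ?w. i mod gap v x = j mod gap v x
      \<longrightarrow> ?w ! i = ?w ! j)"
  proof (intro conjI allI impI)
    show "1 \<le> gap v x"
      using gap_pos[of v x] by simp
  qed (rule shift_invariant_imp_mod_invariant[OF shift])
next
  let ?w = "psi (v @ [x])"
  fix p
  assume p: "1 \<le> p \<and> (\<forall>i<length ?w. \<forall>j<length ?w. i mod p = j mod p \<longrightarrow> ?w ! i = ?w ! j)"
  have shift: "?w ! (i + p) = ?w ! i" if "i + p < length ?w" for i
    by (rule p[THEN conjunct2, rule_format]) (use that in simp_all)
  show "gap v x \<le> p"
  proof (rule ccontr)
    assume "\<not> gap v x \<le> p"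
    \<comment> \<open>A shorter period would leave a proper palindromic prefix longer than
      \<open>psi v\<close>.\<close>
    then have gt: "\<not> length ?w - p \<le> length (psi v)" and le: "p \<le> length ?w"
      by (simp_all add: length_psi_snoc)
    have "palindrome (take (length ?w - p) ?w)"
      by (rule period_imp_palindrome_prefix[OF palindrome_psi le shift])
    moreover have "length ?w - p < length ?w"
      using p gap_pos[of v x] by (simp add: length_psi_snoc)
    ultimately show False
      using pal_prefix_psi_snoc gt by blast
  qed
qed

section \<open>Fibonacci bounds and their equality cases\<close>

lemma letter_cases: "x \<noteq> y \<Longrightarrow> z = x \<or> z = (y :: letter)"
  by (cases x; cases y; cases z) auto

text \<open>The gap of the appended letter is kept and the other one becomes the sum of
  both.\<close>

lemma gap_sum_snoc: "gap (v @ [x]) A + gap (v @ [x]) B = gap v x + (gap v A + gap v B)"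
  by (cases x) (simp_all add: gap_snoc_same gap_snoc_diff)

text \<open>The two bounds need a joint induction: each new gap is at most the old sum, and the new
  sum is an old gap plus the old sum.\<close>

lemma gap_le_fib:
  "gap v x \<le> fib (length v + 2)" "gap v A + gap v B \<le> fib (length v + 3)"
proof -
  have "(\<forall>x. gap v x \<le> fib (length v + 2)) \<and> gap v A + gap v B \<le> fib (length v + 3)"
  proof (induction v rule: rev_induct)
    case Nil
    show ?case by (simp add: gap_Nil eval_nat_numeral)
  next
    case (snoc y v)
    have "gap v z \<le> gap v A + gap v B" for z
      by (cases z) simp_all
    then have "gap (v @ [y]) z \<le> gap v A + gap v B" for z
      by (cases y; cases z) (simp_all add: gap_snoc_same gap_snoc_diff)
    moreover have "gap (v @ [y]) A + gap (v @ [y]) B \<le> fib (length v + 2) + fib (length v + 3)"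
      unfolding gap_sum_snoc using snoc.IH by (meson add_mono)
    ultimately show ?case
      using snoc.IH by (fastforce simp: eval_nat_numeral intro: le_trans)
  qed
  then show "gap v x \<le> fib (length v + 2)" "gap v A + gap v B \<le> fib (length v + 3)"
    by auto
qed

lemma gap_snoc_eq_fib_iff:
  "gap (v @ [y]) x = fib (length v + 3) \<longleftrightarrow> x \<noteq> y \<and> gap v A + gap v B = fib (length v + 3)"
proof (cases "x = y")
  case True
  \<comment> \<open>Repeating a letter keeps the gap at most \<open>fib (length v + 2)\<close>,
    which is strictly below the next Fibonacci number.\<close>
  have "fib (length v + 3) = fib (length v + 2) + fib (length v + 1)" "fib (length v + 1) > 0"
    by (simp_all add: eval_nat_numeral fib_neq_0_nat)
  then show ?thesis
    using True gap_le_fib(1)[of v x] by (simp add: gap_snoc_same)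
next
  case False
  then show ?thesis
    by (cases x; cases y) (simp_all add: gap_snoc_diff add.commute)
qed

lemma gap_sum_eq_fib_iff: "gap v A + gap v B = fib (length v + 3) \<longleftrightarrow> distinct_adj v"
proof (induction v rule: rev_induct)
  case Nil
  show ?case by (simp add: gap_Nil eval_nat_numeral)
next
  case (snoc x v)
  have "gap (v @ [x]) A + gap (v @ [x]) B = fib (length (v @ [x]) + 3)
      \<longleftrightarrow> gap v x + (gap v A + gap v B) = fib (length v + 2) + fib (length v + 3)"
    by (simp add: gap_sum_snoc eval_nat_numeral ac_simps)
  \<comment> \<open>Each summand has its own bound, so the total is extremal only if both
    are.\<close>
  also have "\<dots> \<longleftrightarrow> gap v x = fib (length v + 2) \<and> gap v A + gap v B = fib (length v + 3)"
    using gap_le_fib(1)[of v x] gap_le_fib(2)[of v] by linarith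
  also have "\<dots> \<longleftrightarrow> gap v x = fib (length v + 2) \<and> distinct_adj v"
    using snoc.IH by simp
  also have "\<dots> \<longleftrightarrow> distinct_adj (v @ [x])"
  proof (cases v rule: rev_cases)
    case Nil
    then show ?thesis by (simp add: gap_Nil eval_nat_numeral)
  next
    case (snoc u y)
    have len: "length v + 2 = length u + 3" by (simp add: snoc)
    \<comment> \<open>If \<open>v\<close> alternates, its gap sum is extremal by induction; the same
      splitting at \<open>u\<close> makes the gap sum of \<open>u\<close> extremal. Then
      \<open>gap v x\<close> is extremal exactly when \<open>x\<close> differs from
      \<open>y\<close>.\<close>
    have "gap u A + gap u B = fib (length u + 3)" if "distinct_adj v"
      using snoc.IH that snoc gap_sum_snoc[of u y] gap_le_fib(1)[of u y] gap_le_fib(2)[of u]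
      by (simp add: eval_nat_numeral)
    then show ?thesis
      using gap_snoc_eq_fib_iff[of u y x] unfolding len
      by (auto simp: snoc distinct_adj_append_iff)
  qed
  finally show ?case .
qed

text \<open>For \<open>v = u @ [y]\<close>, equality requires \<open>x\<close> and \<open>y\<close>
  to differ and \<open>u\<close> to alternate. The order of the last two letters remains free, which
  is where \<open>c\<close> enters.\<close>

lemma gap_eq_fib_iff:
  "gap v x = fib (length v + 2) \<longleftrightarrow> distinct_adj (v @ [x]) \<or> distinct_adj (c (v @ [x]))"
proof (cases v rule: rev_cases)
  case Nil
  then show ?thesis by (simp add: gap_Nil eval_nat_numeral)
next
  case (snoc u y)
  have "gap v x = fib (length v + 2) \<longleftrightarrow> x \<noteq> y \<and> distinct_adj u"
    using gap_snoc_eq_fib_iff[of u y x] gap_sum_eq_fib_iff[of u] by (simp add: snoc eval_nat_numeral)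
  \<comment> \<open>Over two letters the last letter of a nonempty \<open>u\<close> equals one of
    \<open>x\<close> and \<open>y\<close>, so one of the two orders continues the
    alternation.\<close>
  also have "\<dots> \<longleftrightarrow> distinct_adj (u @ [y, x]) \<or> distinct_adj (u @ [x, y])"
    using letter_cases[of x y "last u"] by (auto simp: distinct_adj_append_iff)
  finally show ?thesis by (simp add: snoc c_snoc2)
qed

section \<open>Alternating words and the extremal words\<close>

lemma alt_word_Suc: "alt_word (Suc n) = alt_word n @ [if even n then A else B]"
  by (simp add: alt_word_def)

text \<open>Over two letters each letter of an alternating word forces the next, so only the choice
  of the first letter is free.\<close>

lemma distinct_adj_iff_alt_word:
  "distinct_adj v \<longleftrightarrow> v = alt_word (length v) \<or> v = E (alt_word (length v))"
proof (induction v rule: rev_induct)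
  case Nil
  show ?case by (simp add: alt_word_def)
next
  case (snoc x v)
  show ?case
  proof (cases v rule: rev_cases)
    case Nil
    then show ?thesis by (cases x) (simp_all add: alt_word_def E_def)
  next
    case (snoc u y)
    show ?thesis
      using snoc.IH by (cases x; cases y; cases "even (length u)")
        (auto simp: snoc alt_word_Suc E_def distinct_adj_append_iff)
  qed
qed

lemma length_c: "length (c w) = length w"
  by (auto simp: c_def)

lemma c_c: "c (c w) = w"
proof (cases w rule: rev_cases)
  case (snoc u x)
  then show ?thesis
    by (cases u rule: rev_cases) (simp_all add: c_single c_snoc2)
qed (simp add: c_Nil)

lemma E_c: "E (c w) = c (E w)"
proof (cases w rule: rev_cases)
  case (snoc u x)
  then show ?thesis
    by (cases u rule: rev_cases) (simp_all add: E_def c_single c_snoc2)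
qed (simp add: E_def c_Nil)

text \<open>Since \<open>c\<close> is a length-preserving involution commuting with
  \<open>E\<close>, the last two words of the set are those that \<open>c\<close> maps to
  alternating words.\<close>

lemma extremal_iff_distinct_adj:
  assumes "length v = n"
  shows "v \<in> {alt_word n, E (alt_word n), c (alt_word n), E (c (alt_word n))}
    \<longleftrightarrow> distinct_adj v \<or> distinct_adj (c v)"
proof -
  have "c v = w \<longleftrightarrow> v = c w" for w
    using c_c[of v] c_c[of w] by auto
  then show ?thesis
    using assms by (simp add: distinct_adj_iff_alt_word length_c E_c disj_ac)
qed

lemma min_period_psi_bound:
  "min_period (psi v) \<le> F (int (length v) - 1)"
  "min_period (psi v) = F (int (length v) - 1) \<longleftrightarrow> distinct_adj v \<or> distinct_adj (c v)"
proof -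
  have "F (int (length v) - 1) = fib (length v + 1)"
  proof -
    have "int (length v) - 1 + 2 = int (length v + 1)" by simp
    then show ?thesis unfolding F_def by (simp only: nat_int)
  qed
  then have "min_period (psi v) \<le> F (int (length v) - 1) \<and>
    (min_period (psi v) = F (int (length v) - 1) \<longleftrightarrow> distinct_adj v \<or> distinct_adj (c v))"
  proof (cases v rule: rev_cases)
    case Nil
    \<comment> \<open>The convention for the empty word matches the value of \<open>F\<close> at
      -1.\<close>
    then show ?thesis by (simp add: psi_Nil min_period_Nil F_minus_1)
  next
    case (snoc u x)
    have "length v + 1 = length u + 2" by (simp add: snoc)
    then show ?thesis
      using \<open>F _ = _\<close> gap_le_fib(1)[of u x] gap_eq_fib_iff[of u x]
      by (simp add: snoc min_period_psi_snoc)
  qed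
  then show "min_period (psi v) \<le> F (int (length v) - 1)"
    "min_period (psi v) = F (int (length v) - 1) \<longleftrightarrow> distinct_adj v \<or> distinct_adj (c v)"
    by auto
qed

theorem theorem4p5:
  fixes n :: nat and v :: word
  assumes "length v = n"
  shows "min_period (psi v) \<le> min_period (psi (alt_word n))
    \<and> min_period (psi (alt_word n)) = F (int n - 1)
    \<and> (min_period (psi v) = F (int n - 1) \<longleftrightarrow>
        v \<in> {alt_word n, E (alt_word n), c (alt_word n), E (c (alt_word n))})"
proof -
  have len: "length (alt_word n) = n"
    by (simp add: alt_word_def)
  \<comment> \<open>The alternating word attains the general bound, so bounding by \<open>F\<close>
    amounts to comparing with it.\<close>
  have "distinct_adj (alt_word n)"
    using len by (simp add: distinct_adj_iff_alt_word)
  then have "min_period (psi (alt_word n)) = F (int n - 1)"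
    using min_period_psi_bound(2)[of "alt_word n"] len by simp
  then show ?thesis
    using min_period_psi_bound[of v] extremal_iff_distinct_adj[OF assms] assms by simp
qed

end
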